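(* Let $G$ be a finite connected graph with positive edge lengths whose shortest-path metric $d_G$ satisfies $d_G(u,v)=$ length of $uv$ for every edge $uv$, and let $E(G)$ be its edge set with some orientation. Let $\mathcal M=\bigsqcup_{k=0}^{n'}\mathcal M_k$ be a finite index set and $\{\mu_t\}_{t\in\mathcal M}\subseteq\mathrm{TC}(V(G))$. Suppose: (C1) there are $C<\infty$ and $th:E(G)\to(0,\infty)$ with $\sum_{uv\in E(G)}th(uv)d_G(u,v)=1$ such that every $f:V(G)\to\mathbb{R}$ satisfies $$\sum_{k=0}^{n'}\Big(\sum_{t\in\mathcal M_k}\Big|\int f\,d\mu_t\Big|^2\Big)^{1/2}\le C\sum_{uv\in E(G)}|f(u)-f(v)|\,th(uv);$$ (C2) for each $k\in\{0,\dots,n'\}$ there are $\alpha_k\ge0$ and a family $\{\theta_i:\mathcal M_k\to\mathbb{R}\}_{i\in\mathcal M_k}$ of pairwise orthogonal functions (in $\ell_2(\mathcal M_k)$) with $|\theta_i(t)|\le1$ for all $i,t\in\mathcal M_k$ and $\min_{i\in\mathcal M_k}\big\|\sum_{t\in\mathcal M_k}\theta_i(t)\mu_t\big\|_{\mathrm{TC}}\ge\alpha_k$. Then $c_1(\mathrm{TC}(V(G)))\ge C^{-1}\sum_{k=0}^{n'}\alpha_k$.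
   Context: For a finite metric space $(X,d)$, $\mathrm{TC}(X)$ is the space of signed measures $\mu$ on $X$ with $\mu(X)=0$, normed by $\|\mu\|_{\mathrm{TC}}=\inf\sum_i a_id(x_i,y_i)$ over all representations $\mu=\sum_i a_i(\delta_{x_i}-\delta_{y_i})$ with $a_i\ge0$. For a metric space $Y$, $c_1(Y)$ is the infimal $D\ge1$ such that some map $F:Y\to L_1(M)$ (some measure space) satisfies $\rho(x,y)\le\|F(x)-F(y)\|_1\le D\rho(x,y)$. Here $V(G)$ carries the metric $d_G$. *)

theory Defs
  imports "HOL-Analysis.Analysis"
begin

text \<open>A finite graph is given by a vertex set V and a set E of oriented edges
(each undirected edge appears with exactly one orientation). Edge lengths are
given by w (only values on E matter).\<close>

definition adj :: "('v \<times> 'v) set \<Rightarrow> 'v \<Rightarrow> 'v \<Rightarrow> bool" where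
  "adj E u v \<longleftrightarrow> (u, v) \<in> E \<or> (v, u) \<in> E"

definition elen :: "('v \<times> 'v) set \<Rightarrow> ('v \<Rightarrow> 'v \<Rightarrow> real) \<Rightarrow> 'v \<Rightarrow> 'v \<Rightarrow> real" where
  "elen E w u v = (if (u, v) \<in> E then w u v else w v u)"

definition is_walk :: "('v \<times> 'v) set \<Rightarrow> 'v list \<Rightarrow> bool" where
  "is_walk E p \<longleftrightarrow> p \<noteq> [] \<and> (\<forall>(a, b) \<in> set (zip p (tl p)). adj E a b)"

definition walk_length :: "('v \<times> 'v) set \<Rightarrow> ('v \<Rightarrow> 'v \<Rightarrow> real) \<Rightarrow> 'v list \<Rightarrow> real" where
  "walk_length E w p = sum_list (map (\<lambda>(a, b). elen E w a b) (zip p (tl p)))"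

definition connected_graph :: "'v set \<Rightarrow> ('v \<times> 'v) set \<Rightarrow> bool" where
  "connected_graph V E \<longleftrightarrow>
     (\<forall>u\<in>V. \<forall>v\<in>V. \<exists>p. is_walk E p \<and> hd p = u \<and> last p = v)"

definition dG :: "('v \<times> 'v) set \<Rightarrow> ('v \<Rightarrow> 'v \<Rightarrow> real) \<Rightarrow> 'v \<Rightarrow> 'v \<Rightarrow> real" where
  "dG E w u v = Inf {walk_length E w p | p. is_walk E p \<and> hd p = u \<and> last p = v}"

text \<open>Signed measures on V with total mass 0, represented as functions vanishing outside V.\<close>
definition TC :: "'v set \<Rightarrow> ('v \<Rightarrow> real) set" where
  "TC V = {\<mu>. (\<forall>x. x \<notin> V \<longrightarrow> \<mu> x = 0) \<and> sum \<mu> V = 0}"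

definition tc_reps :: "'v set \<Rightarrow> ('v \<Rightarrow> real) \<Rightarrow> (real \<times> 'v \<times> 'v) list set" where
  "tc_reps V \<mu> = {rs. (\<forall>(a, x, y) \<in> set rs. 0 \<le> a \<and> x \<in> V \<and> y \<in> V) \<and>
      \<mu> = (\<lambda>z. sum_list (map (\<lambda>(a, x, y).
              a * ((if z = x then 1 else 0) - (if z = y then 1 else 0))) rs))}"

definition tc_norm :: "('v \<Rightarrow> 'v \<Rightarrow> real) \<Rightarrow> 'v set \<Rightarrow> ('v \<Rightarrow> real) \<Rightarrow> real" where
  "tc_norm d V \<mu> = Inf ((\<lambda>rs. sum_list (map (\<lambda>(a, x, y). a * d x y) rs)) ` tc_reps V \<mu>)"

text \<open>c_1 of a metric space (Y, rho), where the target L_1(M) ranges over all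
measure spaces M on the type 'b (the theorem quantifies over every 'b).
Infimum in the extended reals, so it is \<infinity> if no embedding exists.\<close>
definition c1 :: "'a set \<Rightarrow> ('a \<Rightarrow> 'a \<Rightarrow> real) \<Rightarrow> 'b itself \<Rightarrow> ereal" where
  "c1 Y \<rho> (_ :: 'b itself) = Inf {ereal D | D. 1 \<le> D \<and>
     (\<exists>(M :: 'b measure) (F :: 'a \<Rightarrow> 'b \<Rightarrow> real).
        (\<forall>x\<in>Y. integrable M (F x)) \<and>
        (\<forall>x\<in>Y. \<forall>y\<in>Y. \<rho> x y \<le> (\<integral>\<omega>. \<bar>F x \<omega> - F y \<omega>\<bar> \<partial>M) \<and>
                       (\<integral>\<omega>. \<bar>F x \<omega> - F y \<omega>\<bar> \<partial>M) \<le> D * \<rho> x y))}"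

end

theory Submission
  imports Defs "HOL-Library.Function_Algebras"
begin

text \<open>For a linear map into \<open>L\<^sub>1\<close> of distortion \<open>D\<close>, applying (C1) pointwise on the measure space
  and bounding each \<open>\<ell>\<^sub>2\<close>-norm from below by the average of its coefficients against the \<open>\<theta>\<^sub>i\<close>
  gives \<open>\<Sum>\<alpha>\<^sub>k \<le> C D\<close> after integration. A general map \<open>F\<close> is linearized by a discrete
  differentiation argument: let \<open>G\<close> be the average of \<open>F\<close> over a large lattice box spanned by the
  vectors \<open>e\<^sub>x\<close>. The increments \<open>A\<^sub>x(z) = G(z + e\<^sub>x) - G(z)\<close> satisfy the upper Lipschitz bound exactly
  and vary slowly with \<open>z\<close>, so \<open>e\<^sub>x \<mapsto> A\<^sub>x(z)\<close> extends to a linear map that almost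
  predicts the increments of \<open>G\<close> over bounded distances. Telescoping these along a long line in a given direction
  shows that the lower bound holds for an average \<open>z\<close>; averaging over a grid spanned by all
  relevant directions treats them simultaneously.\<close>

section \<open>Seminorms\<close>

text \<open>Pointwise scaling makes signed measures on \<open>V\<close> and functions on a measure
  space vectors, so that one seminorm locale serves for domain and target.\<close>

instantiation "fun" :: (type, real_vector) real_vector
begin

definition "c *\<^sub>R f = (\<lambda>x. c *\<^sub>R f x)"

instance
  by standard (simp_all add: scaleR_fun_def fun_eq_iff algebra_simps)

end

lemma scaleR_fun_apply [simp]: "(c *\<^sub>R f) x = c *\<^sub>R f x"
  by (simp add: scaleR_fun_def)

lemma sum_fun_apply [simp]: "sum f A x = (\<Sum>a\<in>A. f a x)"
  by (induction A rule: infinite_finite_induct) auto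

locale seminorm =
  fixes p :: "'a :: real_vector \<Rightarrow> real"
  assumes triangle: "p (x + y) \<le> p x + p y"
    and scale: "p (c *\<^sub>R x) = \<bar>c\<bar> * p x"
begin

lemma zero [simp]: "p 0 = 0"
  using scale[of 0 0] by simp

lemma minus [simp]: "p (- x) = p x"
  using scale[of "-1" x] by simp

lemma diff_commute: "p (x - y) = p (y - x)"
  by (metis minus minus_diff_eq)

lemma nonneg [simp]: "0 \<le> p x"
  using triangle[of x "- x"] by simp

lemma triangle_diff: "p (x - y) \<le> p x + p y"
  using triangle[of x "- y"] by simp

lemma reverse_triangle: "p x - p y \<le> p (x - y)"
  using triangle[of "x - y" y] by simp

lemma sum_le: "p (sum f A) \<le> (\<Sum>a\<in>A. p (f a))"
  by (induction A rule: infinite_finite_induct) (auto intro: order_trans[OF triangle])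

lemma sum_scale_le: "p (\<Sum>a\<in>A. c a *\<^sub>R f a) \<le> (\<Sum>a\<in>A. \<bar>c a\<bar> * p (f a))"
  using sum_le[of "\<lambda>a. c a *\<^sub>R f a" A] by (simp add: scale)

end

text \<open>Applying the inequality for \<open>1 / c\<close> to \<open>c *\<^sub>R x\<close> gives
  its converse. For \<open>c = 0\<close>, homogeneity gives \<open>p 0 \<le> 0\<close> and
  subadditivity gives \<open>0 \<le> p 0\<close>.\<close>

lemma seminormI:
  fixes p :: "'a :: real_vector \<Rightarrow> real"
  assumes add: "\<And>x y. p (x + y) \<le> p x + p y"
    and scale: "\<And>c x. p (c *\<^sub>R x) \<le> \<bar>c\<bar> * p x"
  shows "seminorm p"
proof
  fix c x
  show "p (c *\<^sub>R x) = \<bar>c\<bar> * p x"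
  proof (cases "c = 0")
    case True
    then show ?thesis
      using scale[of 0 x] add[of 0 0] by simp
  next
    case False
    then have "p x \<le> p (c *\<^sub>R x) / \<bar>c\<bar>"
      using scale[of "1 / c" "c *\<^sub>R x"] by simp
    then have "\<bar>c\<bar> * p x \<le> p (c *\<^sub>R x)"
      using False by (simp add: pos_le_divide_eq mult.commute)
    then show ?thesis
      using scale[of c x] by (rule antisym[rotated])
  qed
qed (rule add)

text \<open>A linear projection onto the integrable functions makes the \<open>L\<^sub>1\<close> seminorm total.\<close>

lemma exists_integrable_projection:
  fixes M :: "'b measure"
  shows "\<exists>Q :: ('b \<Rightarrow> real) \<Rightarrow> 'b \<Rightarrow> real. linear Q \<and> (\<forall>f. integrable M (Q f)) \<and>
    (\<forall>f. integrable M f \<longrightarrow> Q f = f)"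
proof -
  have "subspace {f :: 'b \<Rightarrow> real. integrable M f}"
    by (auto simp: subspace_def plus_fun_def zero_fun_def scaleR_fun_def)
  from linear_exists_left_inverse_on[OF linear_id this inj_on_id]
  obtain Q :: "('b \<Rightarrow> real) \<Rightarrow> 'b \<Rightarrow> real" where
    "range Q \<subseteq> {f. integrable M f}" "linear Q" "\<forall>f\<in>{f. integrable M f}. Q (id f) = f"
    by blast
  then show ?thesis
    by (intro exI[of _ Q]) auto
qed

lemma seminorm_L1:
  fixes Q :: "('b \<Rightarrow> real) \<Rightarrow> 'b \<Rightarrow> real"
  assumes "linear Q" "\<And>f. integrable M (Q f)"
  shows "seminorm (\<lambda>f. \<integral>\<omega>. \<bar>Q f \<omega>\<bar> \<partial>M)"
proof (rule seminormI)
  fix f g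
  have "(\<integral>\<omega>. \<bar>Q (f + g) \<omega>\<bar> \<partial>M) \<le> (\<integral>\<omega>. \<bar>Q f \<omega>\<bar> + \<bar>Q g \<omega>\<bar> \<partial>M)"
    using assms by (intro integral_mono) (auto simp: linear_add)
  then show "(\<integral>\<omega>. \<bar>Q (f + g) \<omega>\<bar> \<partial>M) \<le> (\<integral>\<omega>. \<bar>Q f \<omega>\<bar> \<partial>M) + (\<integral>\<omega>. \<bar>Q g \<omega>\<bar> \<partial>M)"
    using assms by simp
qed (use assms in \<open>simp add: linear_scale abs_mult\<close>)

section \<open>Averages over lattice boxes\<close>

definition line_avg :: "nat \<Rightarrow> 'g \<Rightarrow> ('g :: real_vector \<Rightarrow> 'y :: real_vector) \<Rightarrow> 'g \<Rightarrow> 'y" where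
  "line_avg n e f z = (1 / n) *\<^sub>R (\<Sum>b<n. f (z + real b *\<^sub>R e))"

text \<open>The mean of \<open>f\<close> over the points \<open>z\<close> plus combinations of
  \<open>es\<close> with coefficients in \<open>{0..<n}\<close>, written as iterated line averages
  so that facts can be proved one direction at a time.\<close>

fun box_avg :: "nat \<Rightarrow> 'g list \<Rightarrow> ('g :: real_vector \<Rightarrow> 'y :: real_vector) \<Rightarrow> 'g \<Rightarrow> 'y" where
  "box_avg n [] f = f"
| "box_avg n (e # es) f = line_avg n e (box_avg n es f)"

lemma line_avg_commute: "line_avg n e (line_avg n e' f) = line_avg n e' (line_avg n e f)"
proof
  fix z
  show "line_avg n e (line_avg n e' f) z = line_avg n e' (line_avg n e f) z"
    unfolding line_avg_def scaleR_sum_right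
    by (subst sum.swap) (simp add: add.assoc add.commute add.left_commute)
qed

text \<open>Averages in different directions commute, so any direction of a box can be made the
  innermost one.\<close>

lemma line_avg_box_avg: "line_avg n e (box_avg n es f) = box_avg n es (line_avg n e f)"
  by (induction es) (simp_all, metis line_avg_commute)

lemma line_avg_shift: "line_avg n e f (z + h) = line_avg n e (\<lambda>z. f (z + h)) z"
  by (simp add: line_avg_def add_ac)

lemma line_avg_diff: "line_avg n e f z - line_avg n e g z = line_avg n e (\<lambda>z. f z - g z) z"
  by (simp add: line_avg_def sum_subtractf scaleR_right_diff_distrib)

text \<open>The sum telescopes to its two ends. This is the source of the factor
  \<open>1 / n\<close> gained by smoothing.\<close>

lemma line_avg_step:
  "line_avg n e f (z + e) - line_avg n e f z = (1 / n) *\<^sub>R (f (z + n *\<^sub>R e) - f z)"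
proof -
  have "line_avg n e f (z + e) - line_avg n e f z
      = (1 / n) *\<^sub>R (\<Sum>b<n. f (z + Suc b *\<^sub>R e) - f (z + real b *\<^sub>R e))"
    by (simp add: line_avg_def sum_subtractf scaleR_right_diff_distrib scaleR_left_distrib add_ac)
  then show ?thesis
    by (subst (asm) sum_lessThan_telescope) simp
qed

lemma line_avg_sum: "line_avg n e (\<lambda>z. \<Sum>i\<in>I. f i z) z = (\<Sum>i\<in>I. line_avg n e (f i) z)"
  unfolding line_avg_def scaleR_sum_right by (rule sum.swap)

lemma line_avg_mono:
  fixes f :: "'g :: real_vector \<Rightarrow> real"
  assumes "\<And>z. f z \<le> g z"
  shows "line_avg n e f z \<le> line_avg n e g z"
  unfolding line_avg_def using assms by (auto intro!: divide_right_mono sum_mono)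

lemma line_avg_const: "n > 0 \<Longrightarrow> line_avg n e (\<lambda>_. c) z = c"
  by (simp add: line_avg_def sum_constant_scaleR)

lemma line_avg_less:
  fixes f :: "'g :: real_vector \<Rightarrow> real"
  assumes "n > 0" "\<And>z. f z < c"
  shows "line_avg n e f z < c"
proof -
  have "(\<Sum>b<n. f (z + real b *\<^sub>R e)) < (\<Sum>b<n. c)"
    using assms by (intro sum_strict_mono) auto
  then show ?thesis
    using assms by (simp add: line_avg_def field_simps)
qed

lemma box_avg_sum: "box_avg n es (\<lambda>z. \<Sum>i\<in>I. f i z) z = (\<Sum>i\<in>I. box_avg n es (f i) z)"
proof (induction es arbitrary: z)
  case (Cons e es)
  have "box_avg n es (\<lambda>z. \<Sum>i\<in>I. f i z) = (\<lambda>z. \<Sum>i\<in>I. box_avg n es (f i) z)"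
    using Cons by blast
  then show ?case
    by (simp add: line_avg_sum)
qed auto

text \<open>Used contrapositively: an average that is at least \<open>c\<close> is attained or
  exceeded at some point.\<close>

lemma box_avg_less:
  fixes f :: "'g :: real_vector \<Rightarrow> real"
  assumes "n > 0" "\<And>z. f z < c"
  shows "box_avg n es f z < c"
  by (induction es arbitrary: z) (auto simp: assms intro!: line_avg_less)

lemma box_avg_ge:
  fixes f :: "'g :: real_vector \<Rightarrow> real"
  assumes "n > 0" "\<And>z. c \<le> f z"
  shows "c \<le> box_avg n es f z"
proof (induction es arbitrary: z)
  case (Cons e es)
  then show ?case
    using line_avg_mono[of "\<lambda>_. c" "box_avg n es f" n e z] by (simp add: line_avg_const assms)
qed (use assms in auto)

text \<open>The average along \<open>e\<close> can be taken first, and the remaining ones preserve a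
  lower bound. One box thus serves bounds that hold along different directions.\<close>

lemma box_avg_ge_direction:
  fixes f :: "'g :: real_vector \<Rightarrow> real"
  assumes "n > 0" "e \<in> set es" "\<And>z. c \<le> line_avg n e f z"
  shows "c \<le> box_avg n es f z"
  using assms(2)
proof (induction es arbitrary: z)
  case (Cons e' es)
  show ?case
  proof (cases "e' = e")
    case True
    then have "box_avg n (e' # es) f = box_avg n es (line_avg n e f)"
      by (simp add: line_avg_box_avg)
    then show ?thesis
      using box_avg_ge[OF assms(1,3)] by simp
  next
    case False
    then have "\<And>z. c \<le> box_avg n es f z"
      using Cons by auto
    then show ?thesis
      using box_avg_ge[OF assms(1), of c "box_avg n es f" "[e']"] by simp
  qed
qed auto

lemma box_avg_scale: "box_avg n es (\<lambda>z. c *\<^sub>R f z) z = c *\<^sub>R box_avg n es f z"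
proof (induction es arbitrary: z)
  case (Cons e es)
  have "box_avg n es (\<lambda>z. c *\<^sub>R f z) = (\<lambda>z. c *\<^sub>R box_avg n es f z)"
    using Cons by blast
  then show ?case
    by (simp add: line_avg_def scaleR_sum_right mult.commute)
qed auto

context seminorm
begin

lemma line_avg_le:
  assumes "n > 0" "\<And>b. b < n \<Longrightarrow> p (f (z + real b *\<^sub>R e)) \<le> B"
  shows "p (line_avg n e f z) \<le> B"
proof -
  have "p (\<Sum>b<n. f (z + real b *\<^sub>R e)) \<le> (\<Sum>b<n. B)"
    using assms by (intro order_trans[OF sum_le] sum_mono) auto
  then show ?thesis
    using assms by (simp add: line_avg_def scale field_simps)
qed

end

section \<open>Lipschitz maps between seminormed spaces and their box averages\<close>

locale lipschitz_between = dom: seminorm \<rho> + cod: seminorm p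
  for \<rho> :: "'g :: real_vector \<Rightarrow> real" and p :: "'y :: real_vector \<Rightarrow> real" +
  fixes D :: real
  assumes D_nonneg: "0 \<le> D"
begin

definition lip :: "('g \<Rightarrow> 'y) \<Rightarrow> bool" where
  "lip f \<longleftrightarrow> (\<forall>x y. p (f x - f y) \<le> D * \<rho> (x - y))"

lemma lip_shift: "lip f \<Longrightarrow> p (f (z + h) - f z) \<le> D * \<rho> h"
  unfolding lip_def by (metis add_diff_cancel_left')

text \<open>An increment of the average is the average of increments over the same vector, so the
  constant \<open>D\<close> is kept exactly.\<close>

lemma lip_line_avg:
  assumes "n > 0" "lip f"
  shows "lip (line_avg n e f)"
proof -
  have "p (line_avg n e f x - line_avg n e f y) \<le> D * \<rho> (x - y)" for x y
  proof -
    have "line_avg n e f x - line_avg n e f y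
        = line_avg n e (\<lambda>z. f (z + (x - y)) - f z) y"
      using line_avg_shift[of n e f y "x - y"] by (simp add: line_avg_diff)
    then show ?thesis
      using assms by (auto intro!: cod.line_avg_le lip_shift)
  qed
  then show ?thesis
    by (simp add: lip_def)
qed

lemma lip_box_avg: "n > 0 \<Longrightarrow> lip f \<Longrightarrow> lip (box_avg n es f)"
  by (induction es) (auto intro: lip_line_avg)

text \<open>Averaging in direction \<open>e\<close> evaluates at points less than \<open>n\<close>
  steps away, which costs at most \<open>D * (n * \<rho> e)\<close>; the costs add up over the
  list.\<close>

lemma box_avg_close:
  assumes "n > 0" "lip f"
  shows "p (box_avg n es f z - f z) \<le> n * D * (\<Sum>e\<leftarrow>es. \<rho> e)"
proof (induction es arbitrary: z)
  case (Cons e es)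
  let ?g = "box_avg n es f"
  have "line_avg n e ?g z - ?g z = line_avg n e (\<lambda>x. ?g x - ?g z) z"
    using line_avg_diff[of n e ?g z "\<lambda>_. ?g z"] assms by (simp add: line_avg_const)
  also have "p \<dots> \<le> D * (n * \<rho> e)"
  proof (rule cod.line_avg_le)
    fix b assume "b < n"
    have "p (?g (z + real b *\<^sub>R e) - ?g z) \<le> D * \<rho> (real b *\<^sub>R e)"
      using assms by (intro lip_shift lip_box_avg)
    also have "\<dots> \<le> D * (n * \<rho> e)"
      using \<open>b < n\<close> D_nonneg by (auto simp: dom.scale intro!: mult_left_mono mult_right_mono)
    finally show "p (?g (z + real b *\<^sub>R e) - ?g z) \<le> D * (n * \<rho> e)" .
  qed fact
  finally have "p (line_avg n e ?g z - ?g z) \<le> D * (n * \<rho> e)" .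
  moreover have "p (line_avg n e ?g z - f z) \<le> p (line_avg n e ?g z - ?g z) + p (?g z - f z)"
    using cod.triangle[of "line_avg n e ?g z - ?g z" "?g z - f z"] by simp
  ultimately show ?case
    using Cons[of z] by (simp add: algebra_simps)
qed auto

text \<open>Averaging along \<open>e\<close> telescopes the increment in direction \<open>e\<close>; further averages keep the bound.\<close>

lemma box_avg_second_diff:
  assumes "n > 0" "lip f" "e \<in> set es"
  shows "p ((box_avg n es f (z + h + e) - box_avg n es f (z + h))
            - (box_avg n es f (z + e) - box_avg n es f z)) \<le> 2 * D / n * \<rho> h"
  using assms(3)
proof (induction es arbitrary: z)
  case (Cons e' es)
  let ?g = "box_avg n es f"
  show ?case
  proof (cases "e' = e")
    case True
    \<comment> \<open>Telescoping leaves two increments of \<open>?g\<close> over \<open>h\<close>,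
      based at \<open>z + n *\<^sub>R e\<close> and at \<open>z\<close>, each of size at most
      \<open>D * \<rho> h\<close>.\<close>
    have "(line_avg n e ?g (z + h + e) - line_avg n e ?g (z + h))
          - (line_avg n e ?g (z + e) - line_avg n e ?g z)
        = (1 / n) *\<^sub>R ((?g (z + n *\<^sub>R e + h) - ?g (z + n *\<^sub>R e)) - (?g (z + h) - ?g z))"
      by (simp only: line_avg_step) (simp add: algebra_simps)
    also have "p \<dots> \<le> (1 / n) * (D * \<rho> h + D * \<rho> h)"
      unfolding cod.scale using assms
      by (intro mult_mono order_trans[OF cod.triangle_diff] add_mono lip_shift lip_box_avg) auto
    finally show ?thesis
      using True by simp
  next
    case False
    define d where "d z = (?g (z + h + e) - ?g (z + h)) - (?g (z + e) - ?g z)" for z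
    have "(line_avg n e' ?g (z + h + e) - line_avg n e' ?g (z + h))
          - (line_avg n e' ?g (z + e) - line_avg n e' ?g z) = line_avg n e' d z"
      unfolding d_def add.assoc[of z h e] line_avg_shift line_avg_diff
      by (simp add: add.assoc)
    moreover have "p (line_avg n e' d z) \<le> 2 * D / n * \<rho> h"
      using Cons False assms by (intro cod.line_avg_le) (auto simp: d_def)
    ultimately show ?thesis
      by simp
  qed
qed auto

end

section \<open>Linearization of Lipschitz maps\<close>

lemma exists_nat_large:
  fixes c \<epsilon> :: real
  assumes "0 < \<epsilon>"
  shows "\<exists>n > 0. c / real n \<le> \<epsilon>"
proof -
  obtain n where "c / \<epsilon> < real n"
    using reals_Archimedean2 by blast
  then have "c < \<epsilon> * real (Suc n)"
    using assms by (simp add: field_simps)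
  then show ?thesis
    by (intro exI[of _ "Suc n"]) (simp add: field_simps)
qed

context lipschitz_between
begin

text \<open>Walk from \<open>z + h\<close> in \<open>\<bar>m\<bar>\<close> unit steps along
  \<open>e\<close>. Each step differs from the increment at \<open>z\<close> by at most
  \<open>\<kappa>\<close> times a displacement of seminorm at most
  \<open>\<rho> h + \<bar>m\<bar> * \<rho> e\<close>.\<close>

lemma second_diff_int_multiple:
  fixes m :: int
  assumes "0 \<le> \<kappa>"
    and G: "\<And>z h. p ((G (z + h + e) - G (z + h)) - (G (z + e) - G z)) \<le> \<kappa> * \<rho> h"
  shows "p (G (z + h + of_int m *\<^sub>R e) - G (z + h) - of_int m *\<^sub>R (G (z + e) - G z))
    \<le> \<kappa> * \<bar>of_int m\<bar> * (\<rho> h + \<bar>of_int m\<bar> * \<rho> e)"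
proof -
  let ?A = "G (z + e) - G z"
  let ?T = "\<lambda>c. G (z + h + c *\<^sub>R e) - G (z + h) - c *\<^sub>R ?A"
  have le: "\<rho> (h + c *\<^sub>R e) \<le> \<rho> h + \<bar>c\<bar> * \<rho> e" for c
    using dom.triangle[of h "c *\<^sub>R e"] by (simp add: dom.scale)
  have pos: "p (?T (real k)) \<le> \<kappa> * k * (\<rho> h + k * \<rho> e)"
    and neg: "p (?T (- real k)) \<le> \<kappa> * k * (\<rho> h + k * \<rho> e)" for k
  proof (induction k)
    case (Suc k)
    \<comment> \<open>One estimate covers both signs: the forward step is based at displacement
      \<open>h + k e\<close>, the backward one at \<open>h - (k + 1) e\<close>, hence the factor
      \<open>k + 1\<close>.\<close>
    have arith: "\<kappa> * k * (\<rho> h + k * \<rho> e) + \<kappa> * (\<rho> h + (k + 1) * \<rho> e)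
        \<le> \<kappa> * Suc k * (\<rho> h + Suc k * \<rho> e)"
    proof -
      have "\<kappa> * Suc k * (\<rho> h + Suc k * \<rho> e)
          = \<kappa> * k * (\<rho> h + k * \<rho> e) + \<kappa> * (\<rho> h + (k + 1) * \<rho> e) + \<kappa> * k * \<rho> e"
        by (simp add: algebra_simps)
      then show ?thesis
        using assms(1) by simp
    qed
    {
      case 1
      have "?T (real (Suc k)) = ?T (real k)
          + ((G (z + (h + real k *\<^sub>R e) + e) - G (z + (h + real k *\<^sub>R e))) - ?A)"
      proof -
        have "z + h + real (Suc k) *\<^sub>R e = z + (h + real k *\<^sub>R e) + e"
          by (simp add: algebra_simps)
        moreover have "real (Suc k) *\<^sub>R ?A = real k *\<^sub>R ?A + ?A"
          by (simp add: scaleR_left_distrib)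
        ultimately show ?thesis
          by (simp add: add.assoc)
      qed
      then have "p (?T (real (Suc k))) \<le> p (?T (real k)) + \<kappa> * \<rho> (h + real k *\<^sub>R e)"
        by (simp only: order_trans[OF cod.triangle add_left_mono[OF G]])
      also have "\<dots> \<le> \<kappa> * k * (\<rho> h + k * \<rho> e) + \<kappa> * (\<rho> h + (k + 1) * \<rho> e)"
        using Suc le[of k] assms(1)
        by (intro add_mono mult_left_mono) (auto simp: distrib_right intro: order_trans)
      finally show ?case
        using arith by linarith
    next
      case 2
      \<comment> \<open>A backward step is a forward step from \<open>z + ?h\<close> taken with the
        opposite sign.\<close>
      let ?h = "h - real (Suc k) *\<^sub>R e"
      have h': "\<rho> ?h \<le> \<rho> h + (k + 1) * \<rho> e"
        using dom.triangle_diff[of h "real (Suc k) *\<^sub>R e"] by (simp add: dom.scale add_ac)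
      have "?T (- real (Suc k)) = ?T (- real k)
          - ((G (z + ?h + e) - G (z + ?h)) - ?A)"
      proof -
        have "z + h + (- real (Suc k)) *\<^sub>R e = z + ?h"
          "z + h + (- real k) *\<^sub>R e = z + ?h + e"
          by (simp_all add: algebra_simps)
        moreover have "(- real (Suc k)) *\<^sub>R ?A = (- real k) *\<^sub>R ?A - ?A"
          by (simp add: scaleR_left_diff_distrib)
        moreover have "a - b - (s - d) = (a' - b - s) - ((a' - a) - d)" for a a' b d s :: 'y
          by simp
        ultimately show ?thesis
          by (simp only:)
      qed
      then have "p (?T (- real (Suc k))) \<le> p (?T (- real k)) + \<kappa> * \<rho> ?h"
        by (simp only: order_trans[OF cod.triangle_diff add_left_mono[OF G]])
      also have "\<dots> \<le> \<kappa> * k * (\<rho> h + k * \<rho> e) + \<kappa> * (\<rho> h + (k + 1) * \<rho> e)"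
        by (intro add_mono mult_left_mono Suc h' assms(1))
      finally show ?case
        using arith by linarith
    }
  qed auto
  show ?thesis
  proof (cases "0 \<le> m")
    case True
    then show ?thesis
      using pos[of "nat m"] by simp
  next
    case False
    then show ?thesis
      using neg[of "nat (- m)"] by simp
  qed
qed

text \<open>The directions are added one at a time, with the partial combination already reached as
  the displacement \<open>h\<close> of the one-direction estimate.\<close>

lemma second_diff_int_combination:
  fixes m :: "'i \<Rightarrow> int"
  assumes "finite W" "0 \<le> \<kappa>"
    and G: "\<And>x z h. x \<in> W \<Longrightarrow>
      p ((G (z + h + e x) - G (z + h)) - (G (z + e x) - G z)) \<le> \<kappa> * \<rho> h"
  shows "p (G (z + (\<Sum>x\<in>W. of_int (m x) *\<^sub>R e x)) - G z
            - (\<Sum>x\<in>W. of_int (m x) *\<^sub>R (G (z + e x) - G z)))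
    \<le> \<kappa> * (\<Sum>x\<in>W. \<bar>of_int (m x)\<bar>) * (\<Sum>x\<in>W. \<bar>of_int (m x)\<bar> * \<rho> (e x))"
  using assms(1) G
proof (induction W)
  case (insert x W)
  let ?h = "\<Sum>x\<in>W. of_int (m x) *\<^sub>R e x"
  let ?T = "\<Sum>x\<in>W. of_int (m x) *\<^sub>R (G (z + e x) - G z)"
  let ?s = "\<Sum>x\<in>W. \<bar>real_of_int (m x)\<bar>" and ?r = "\<Sum>x\<in>W. \<bar>of_int (m x)\<bar> * \<rho> (e x)"
  let ?c = "\<bar>real_of_int (m x)\<bar>"
  have "p ((G (z + ?h + of_int (m x) *\<^sub>R e x) - G (z + ?h) - of_int (m x) *\<^sub>R (G (z + e x) - G z))
          + (G (z + ?h) - G z - ?T))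
      \<le> \<kappa> * ?c * (\<rho> ?h + ?c * \<rho> (e x)) + \<kappa> * ?s * ?r"
    using insert assms(2)
    by (intro order_trans[OF cod.triangle] add_mono second_diff_int_multiple) auto
  \<comment> \<open>Both terms are enlarged to share the factor
    \<open>?r + ?c * \<rho> (e x)\<close>, so that the bound factors again.\<close>
  also have "\<dots> \<le> \<kappa> * ?c * (?r + ?c * \<rho> (e x)) + \<kappa> * ?s * (?r + ?c * \<rho> (e x))"
    using assms(2) dom.sum_scale_le[of "\<lambda>x. of_int (m x)" e W]
    by (intro add_mono mult_left_mono) (auto intro!: mult_nonneg_nonneg sum_nonneg)
  also have "\<dots> = \<kappa> * (?c + ?s) * (?c * \<rho> (e x) + ?r)"
    by (simp add: algebra_simps)
  finally have "p ((G (z + ?h + of_int (m x) *\<^sub>R e x) - G (z + ?h)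
          - of_int (m x) *\<^sub>R (G (z + e x) - G z)) + (G (z + ?h) - G z - ?T))
      \<le> \<kappa> * (?c + ?s) * (?c * \<rho> (e x) + ?r)" .
  moreover have "z + ?h + of_int (m x) *\<^sub>R e x = z + (of_int (m x) *\<^sub>R e x + ?h)"
    by simp
  moreover have "(a - b - t) + (b - g - t') = a - g - (t + t')" for a b t g t' :: 'y
    by simp
  ultimately show ?case
    by (simp only: sum.insert[OF insert(1,2)])
qed auto

text \<open>Over \<open>J\<close> steps along \<open>m\<close> the lower bound for \<open>F\<close>
  transfers to \<open>G\<close> at a total cost of \<open>2 * \<delta>\<close>. Telescoping and
  division by \<open>J\<close> spread this cost, while \<open>err\<close> is paid once per
  step.\<close>

lemma almost_linear_line_avg:
  fixes e :: "'i \<Rightarrow> 'g"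
  assumes "J > 0"
    and T: "\<And>z. p (G (z + m) - G z - T z) \<le> err"
    and F: "\<And>x y. \<rho> (x - y) \<le> p (F x - F y)"
    and close: "\<And>z. p (G z - F z) \<le> \<delta>"
  shows "\<rho> m - 2 * \<delta> / J - err \<le> line_avg J m (\<lambda>z. p (T z)) z"
proof -
  have step: "p (G (x + m) - G x) \<le> p (T x) + err" for x
    using cod.triangle[of "T x" "G (x + m) - G x - T x"] T[of x] by simp
  have "G (z + real J *\<^sub>R m) - G z
      = (\<Sum>b<J. G (z + real b *\<^sub>R m + m) - G (z + real b *\<^sub>R m))"
    using sum_lessThan_telescope[of "\<lambda>b. G (z + real b *\<^sub>R m)" J]
    by (simp add: algebra_simps)
  then have "p (G (z + real J *\<^sub>R m) - G z) \<le> (\<Sum>b<J. p (T (z + real b *\<^sub>R m)) + err)"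
    using step by (auto intro!: order_trans[OF cod.sum_le] sum_mono)
  then have 1: "p (G (z + real J *\<^sub>R m) - G z) \<le> J * line_avg J m (\<lambda>z. p (T z)) z + J * err"
    using \<open>J > 0\<close> by (simp add: line_avg_def sum.distrib)
  have "J * \<rho> m \<le> p (F (z + real J *\<^sub>R m) - F z)"
    using F[of "z + real J *\<^sub>R m" z] by (simp add: dom.scale)
  also have "\<dots> = p ((G (z + real J *\<^sub>R m) - G z)
      - ((G (z + real J *\<^sub>R m) - F (z + real J *\<^sub>R m)) - (G z - F z)))"
    by simp
  also have "\<dots> \<le> p (G (z + real J *\<^sub>R m) - G z) + (\<delta> + \<delta>)"
    by (rule order_trans[OF cod.triangle_diff add_left_mono[OF
      order_trans[OF cod.triangle_diff add_mono[OF close close]]]])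
  finally have "J * \<rho> m \<le> J * (line_avg J m (\<lambda>z. p (T z)) z + err) + 2 * \<delta>"
    using 1 by (simp add: algebra_simps)
  then show ?thesis
    using \<open>J > 0\<close> by (simp add: field_simps)
qed

text \<open>The scales are chosen in the order \<open>R\<close> (rounding \<open>R\<close> times the target vectors to the lattice), then \<open>n\<close>
  (the side of the smoothing box), then \<open>J\<close> (the length over which increments are averaged).\<close>

lemma linearization:
  fixes e :: "'w \<Rightarrow> 'g" and c :: "'i \<Rightarrow> 'w \<Rightarrow> real" and lam :: "'i \<Rightarrow> real"
  assumes "finite W" "finite I" "0 < \<epsilon>" "\<And>i. i \<in> I \<Longrightarrow> 0 \<le> lam i"
    and lower: "\<And>x y. \<rho> (x - y) \<le> p (F x - F y)" and "lip F"
  shows "\<exists>A. (\<forall>u v. p (A u - A v) \<le> D * \<rho> (e u - e v)) \<and>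
    (\<Sum>i\<in>I. lam i * (\<rho> (\<Sum>x\<in>W. c i x *\<^sub>R e x) - \<epsilon>))
      \<le> (\<Sum>i\<in>I. lam i * p (\<Sum>x\<in>W. c i x *\<^sub>R A x))"
proof -
  have \<epsilon>: "0 < \<epsilon> / 3"
    using assms(3) by simp
  define K where "K = (\<Sum>x\<in>W. \<rho> (e x))"
  have K: "0 \<le> K"
    by (auto simp: K_def intro: sum_nonneg)
  obtain xs where xs: "set xs = W" "distinct xs"
    using finite_distinct_list[OF assms(1)] by blast
  \<comment> \<open>Rounding the coefficients \<open>R * c i x\<close> to integers changes the
    combination of the \<open>e x\<close> by at most \<open>K\<close> and that of the increments by
    at most \<open>D * K\<close>.\<close>
  obtain R :: nat where R: "R > 0" "(K + D * K) / R \<le> \<epsilon> / 3"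
    using exists_nat_large[OF \<epsilon>] by blast
  define m where "m i x = \<lfloor>R * c i x\<rfloor>" for i x
  define mv where "mv i = (\<Sum>x\<in>W. of_int (m i x) *\<^sub>R e x)" for i
  define s where "s i = (\<Sum>x\<in>W. \<bar>real_of_int (m i x)\<bar>)" for i
  define r where "r i = (\<Sum>x\<in>W. \<bar>of_int (m i x)\<bar> * \<rho> (e x))" for i
  have sr: "0 \<le> s i * r i" for i
    by (auto simp: s_def r_def intro!: mult_nonneg_nonneg sum_nonneg)
  \<comment> \<open>The sum over \<open>I\<close> dominates each \<open>s i * r i\<close>, so a
    single \<open>n\<close> suits all targets.\<close>
  obtain n :: nat where n: "n > 0" "2 * D * (\<Sum>i\<in>I. s i * r i) / n \<le> \<epsilon> / 3"
    using exists_nat_large[OF \<epsilon>] by blast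
  \<comment> \<open>Here \<open>n * D * K\<close> is the distance between \<open>F\<close> and its
    box average, fixed once \<open>n\<close> is chosen.\<close>
  obtain J :: nat where J: "J > 0" "2 * (n * D * K) / J \<le> \<epsilon> / 3"
    using exists_nat_large[OF \<epsilon>] by blast
  define G where "G = box_avg n (map e xs) F"
  define A where "A z x = G (z + e x) - G z" for z x
  define T where "T i z = (\<Sum>x\<in>W. c i x *\<^sub>R A z x)" for i z
  define Tm where "Tm i z = (\<Sum>x\<in>W. of_int (m i x) *\<^sub>R A z x)" for i z
  have lipG: "lip G"
    unfolding G_def using n assms by (intro lip_box_avg)
  have frac: "\<bar>of_int (m i x) - R * c i x\<bar> \<le> 1" for i x
    unfolding m_def by linarith
  have round_dom: "R * \<rho> (\<Sum>x\<in>W. c i x *\<^sub>R e x) - K \<le> \<rho> (mv i)" for i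
  proof -
    have "R * \<rho> (\<Sum>x\<in>W. c i x *\<^sub>R e x) = \<rho> (\<Sum>x\<in>W. (R * c i x) *\<^sub>R e x)"
      using dom.scale[of R "\<Sum>x\<in>W. c i x *\<^sub>R e x"] by (simp add: scaleR_sum_right)
    also have "\<dots> - \<rho> (mv i) \<le> \<rho> ((\<Sum>x\<in>W. (R * c i x) *\<^sub>R e x) - mv i)"
      by (rule dom.reverse_triangle)
    also have "\<dots> = \<rho> (\<Sum>x\<in>W. (of_int (m i x) - R * c i x) *\<^sub>R e x)"
      unfolding mv_def by (subst dom.diff_commute) (simp add: scaleR_diff_left sum_subtractf)
    also have "\<dots> \<le> (\<Sum>x\<in>W. 1 * \<rho> (e x))"
      by (intro order_trans[OF dom.sum_scale_le] sum_mono mult_right_mono frac) auto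
    finally show ?thesis
      by (simp add: K_def)
  qed
  have round_cod: "p (Tm i z) - D * K \<le> R * p (T i z)" for i z
  proof -
    have "p (Tm i z) - R * p (T i z) = p (Tm i z) - p (\<Sum>x\<in>W. (R * c i x) *\<^sub>R A z x)"
      using cod.scale[of R "T i z"] by (simp add: scaleR_sum_right T_def)
    also have "\<dots> \<le> p (Tm i z - (\<Sum>x\<in>W. (R * c i x) *\<^sub>R A z x))"
      by (rule cod.reverse_triangle)
    also have "\<dots> = p (\<Sum>x\<in>W. (of_int (m i x) - R * c i x) *\<^sub>R A z x)"
      unfolding Tm_def by (simp add: scaleR_diff_left sum_subtractf)
    also have "\<dots> \<le> (\<Sum>x\<in>W. 1 * (D * \<rho> (e x)))"
      by (intro order_trans[OF cod.sum_scale_le] sum_mono mult_mono frac)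
        (auto simp: A_def intro: lip_shift[OF lipG])
    finally show ?thesis
      by (simp add: K_def sum_distrib_left)
  qed
  have line: "\<rho> (\<Sum>x\<in>W. c i x *\<^sub>R e x) - \<epsilon> \<le> line_avg J (mv i) (\<lambda>z. p (T i z)) z"
    if "i \<in> I" for i z
  proof -
    have err: "p (G (y + mv i) - G y - Tm i y) \<le> \<epsilon> / 3" for y
    proof -
      have "p (G (y + mv i) - G y - Tm i y) \<le> 2 * D / n * s i * r i"
        unfolding mv_def Tm_def s_def r_def A_def
      proof (rule second_diff_int_combination)
        fix x y h assume "x \<in> W"
        then show "p ((G (y + h + e x) - G (y + h)) - (G (y + e x) - G y)) \<le> 2 * D / n * \<rho> h"
          unfolding G_def using n assms xs by (intro box_avg_second_diff) auto
      qed (use assms D_nonneg in auto)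
      also have "\<dots> \<le> 2 * D / n * (\<Sum>i\<in>I. s i * r i)"
        using that assms(2) sr D_nonneg
        by (subst mult.assoc, intro mult_left_mono member_le_sum[of i I "\<lambda>i. s i * r i"]) auto
      finally show ?thesis
        using n by simp
    qed
    have close: "p (G y - F y) \<le> n * D * K" for y
      using box_avg_close[OF n(1) \<open>lip F\<close>, of "map e xs" y] xs
      by (simp add: G_def K_def sum_list_distinct_conv_sum_set o_def)
    have "\<rho> (mv i) - 2 * (n * D * K) / J - \<epsilon> / 3 \<le> line_avg J (mv i) (\<lambda>z. p (Tm i z)) z"
      using J(1) err lower close by (rule almost_linear_line_avg)
    also have "\<dots> \<le> line_avg J (mv i) (\<lambda>z. R * p (T i z) + D * K) z"
      using round_cod by (intro line_avg_mono) (simp add: algebra_simps)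
    also have "\<dots> = R * line_avg J (mv i) (\<lambda>z. p (T i z)) z + D * K"
      using J(1) by (simp add: line_avg_def sum.distrib sum_distrib_left field_simps)
    finally have "R * \<rho> (\<Sum>x\<in>W. c i x *\<^sub>R e x) - (K + D * K) - 2 * (\<epsilon> / 3)
        \<le> R * line_avg J (mv i) (\<lambda>z. p (T i z)) z"
      using round_dom[of i] J(2) by linarith
    moreover have "K + D * K \<le> R * (\<epsilon> / 3)"
      using R by (simp add: field_simps)
    \<comment> \<open>The smoothing and telescoping errors do not carry the factor \<open>R\<close>;
      since \<open>R \<ge> 1\<close> they are absorbed after scaling.\<close>
    moreover have "2 * (\<epsilon> / 3) \<le> R * (2 * (\<epsilon> / 3))"
      using R(1) assms(3) by simp
    ultimately have "R * (\<rho> (\<Sum>x\<in>W. c i x *\<^sub>R e x) - \<epsilon>) \<le> R * line_avg J (mv i) (\<lambda>z. p (T i z)) z"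
      by (simp add: algebra_simps)
    then show ?thesis
      using R(1) by simp
  qed
  obtain js where js: "set js = I"
    using finite_list[OF assms(2)] by blast
  let ?L = "\<Sum>i\<in>I. lam i * (\<rho> (\<Sum>x\<in>W. c i x *\<^sub>R e x) - \<epsilon>)"
  let ?f = "\<lambda>z. \<Sum>i\<in>I. lam i *\<^sub>R p (T i z)"
  \<comment> \<open>The box spanned by all \<open>mv i\<close> yields one base point
    \<open>z\<close> for the whole weighted sum, which is why the conclusion is a sum and not a
    bound for each \<open>i\<close>.\<close>
  have "?L \<le> (\<Sum>i\<in>I. lam i *\<^sub>R box_avg J (map mv js) (\<lambda>z. p (T i z)) 0)"
    unfolding real_scaleR_def using J(1) js assms(4) line
    by (intro sum_mono mult_left_mono box_avg_ge_direction) auto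
  also have "\<dots> = box_avg J (map mv js) ?f 0"
    by (simp only: box_avg_sum box_avg_scale)
  finally obtain z where "?L \<le> ?f z"
    using box_avg_less[OF J(1), of ?f ?L "map mv js" 0] by (meson not_le)
  \<comment> \<open>The common term \<open>G z\<close> cancels, so the Lipschitz bound for
    \<open>G\<close> applies without error.\<close>
  moreover have "p (A z u - A z v) \<le> D * \<rho> (e u - e v)" for u v
    using lipG unfolding lip_def A_def by (metis add_diff_cancel_left diff_diff_eq2 diff_add_cancel)
  ultimately show ?thesis
    by (intro exI[of _ "A z"]) (simp add: T_def)
qed

end

section \<open>Shortest paths and the transportation cost norm\<close>

lemma zip_tl_rev: "zip (rev p) (tl (rev p)) = rev (map prod.swap (zip p (tl p)))"
  by (rule nth_equalityI) (auto simp: rev_nth nth_tl Suc_diff_Suc)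

lemma walk_length_nonneg:
  assumes "\<forall>(u, v) \<in> E. 0 < w u v" "is_walk E p"
  shows "0 \<le> walk_length E w p"
  using assms unfolding walk_length_def is_walk_def adj_def elen_def
  by (intro sum_list_nonneg) (force dest: less_imp_le)

lemma is_walk_rev: "is_walk E p \<Longrightarrow> is_walk E (rev p)"
  by (auto simp: is_walk_def zip_tl_rev adj_def)

text \<open>Every edge has a single orientation, so \<open>elen\<close> is symmetric on adjacent
  vertices.\<close>

lemma walk_length_rev:
  assumes "\<forall>u v. (u, v) \<in> E \<longrightarrow> (v, u) \<notin> E" "is_walk E p"
  shows "walk_length E w (rev p) = walk_length E w p"
proof -
  have "(\<Sum>x\<leftarrow>zip p (tl p). elen E w (snd x) (fst x)) = (\<Sum>x\<leftarrow>zip p (tl p). elen E w (fst x) (snd x))"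
  proof (intro arg_cong[where f = sum_list] map_cong refl)
    fix x assume "x \<in> set (zip p (tl p))"
    then have "adj E (fst x) (snd x)"
      using assms(2) by (auto simp: is_walk_def)
    then show "elen E w (snd x) (fst x) = elen E w (fst x) (snd x)"
      using assms(1)[rule_format, of "fst x" "snd x"] by (auto simp: adj_def elen_def)
  qed
  then show ?thesis
    unfolding walk_length_def zip_tl_rev rev_map[symmetric] map_map sum_list_rev
    by (simp add: o_def case_prod_unfold)
qed

lemma dG_commute:
  assumes "\<forall>u v. (u, v) \<in> E \<longrightarrow> (v, u) \<notin> E"
  shows "dG E w u v = dG E w v u"
proof -
  have sub: "{walk_length E w p | p. is_walk E p \<and> hd p = u \<and> last p = v}
      \<subseteq> {walk_length E w p | p. is_walk E p \<and> hd p = v \<and> last p = u}" for u v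
  proof clarify
    fix p assume p: "is_walk E p"
    then have "p \<noteq> []"
      by (simp add: is_walk_def)
    then show "\<exists>q. walk_length E w p = walk_length E w q \<and> is_walk E q \<and> hd q = last p \<and> last q = hd p"
      using walk_length_rev[OF assms p, of w] is_walk_rev[OF p]
      by (intro exI[of _ "rev p"]) (simp add: hd_rev last_rev)
  qed
  show ?thesis
    unfolding dG_def by (intro arg_cong[where f = Inf] subset_antisym sub)
qed

lemma dG_nonneg:
  assumes "\<forall>(u, v) \<in> E. 0 < w u v" "connected_graph V E" "u \<in> V" "v \<in> V"
  shows "0 \<le> dG E w u v"
  unfolding dG_def
proof (rule cInf_greatest)
  show "{walk_length E w p | p. is_walk E p \<and> hd p = u \<and> last p = v} \<noteq> {}"
    using assms(2-4) unfolding connected_graph_def by blast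
qed (auto intro: walk_length_nonneg[OF assms(1)])

section \<open>The transportation cost as a seminorm\<close>

locale transport =
  fixes V :: "'v set" and d :: "'v \<Rightarrow> 'v \<Rightarrow> real" and r :: 'v
  assumes fin: "finite V" and root: "r \<in> V"
    and d_nonneg: "u \<in> V \<Longrightarrow> v \<in> V \<Longrightarrow> 0 \<le> d u v"
    and d_commute: "u \<in> V \<Longrightarrow> v \<in> V \<Longrightarrow> d u v = d v u"
begin

abbreviation cost :: "(real \<times> 'v \<times> 'v) list \<Rightarrow> real" where
  "cost rs \<equiv> \<Sum>(a, x, y)\<leftarrow>rs. a * d x y"

lemma cost_nonneg: "rs \<in> tc_reps V \<mu> \<Longrightarrow> 0 \<le> cost rs"
  by (intro sum_list_nonneg) (auto simp: tc_reps_def intro!: mult_nonneg_nonneg d_nonneg)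

lemma tc_norm_le: "rs \<in> tc_reps V \<mu> \<Longrightarrow> tc_norm d V \<mu> \<le> cost rs"
  unfolding tc_norm_def by (intro cInf_lower bdd_belowI[of _ 0]) (auto intro: cost_nonneg)

text \<open>Ship each mass \<open>\<mu> x\<close> to or from the base point \<open>r\<close>; what
  accumulates at \<open>r\<close> is the total mass, which is zero. This keeps the infimum in
  \<open>tc_norm\<close> from ranging over the empty set.\<close>

lemma tc_reps_nonempty:
  assumes "\<mu> \<in> TC V"
  shows "tc_reps V \<mu> \<noteq> {}"
proof -
  obtain xs where xs: "set xs = V" "distinct xs"
    using finite_distinct_list[OF fin] by blast
  let ?rs = "map (\<lambda>x. if 0 \<le> \<mu> x then (\<mu> x, x, r) else (- \<mu> x, r, x)) xs"
  have "(\<Sum>(a, x, y)\<leftarrow>?rs. a * ((if z = x then 1 else 0) - (if z = y then 1 else 0))) = \<mu> z" for z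
  proof -
    have "(\<Sum>(a, x, y)\<leftarrow>?rs. a * ((if z = x then 1 else 0) - (if z = y then 1 else 0)))
        = (\<Sum>x\<leftarrow>xs. \<mu> x * ((if z = x then 1 else 0) - (if z = r then 1 else 0)))"
      by (auto simp: o_def intro!: arg_cong[where f = sum_list])
    also have "\<dots> = (\<Sum>x\<in>V. \<mu> x * (if z = x then 1 else 0)) - (\<Sum>x\<in>V. \<mu> x) * (if z = r then 1 else 0)"
      using xs by (simp add: sum_list_distinct_conv_sum_set right_diff_distrib sum_subtractf
          flip: sum_distrib_right)
    also have "\<dots> = \<mu> z"
      using assms fin by (auto simp: TC_def if_distrib cong: if_cong)
    finally show ?thesis .
  qed
  then have "?rs \<in> tc_reps V \<mu>"
    using xs root by (auto simp: tc_reps_def fun_eq_iff)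
  then show ?thesis
    by blast
qed

lemma tc_norm_greatest:
  assumes "\<mu> \<in> TC V" "\<And>rs. rs \<in> tc_reps V \<mu> \<Longrightarrow> c \<le> cost rs"
  shows "c \<le> tc_norm d V \<mu>"
  unfolding tc_norm_def using tc_reps_nonempty assms by (intro cInf_greatest) auto

text \<open>Representations concatenate and their costs add; the two infima are then taken one after
  the other.\<close>

lemma tc_norm_triangle:
  assumes "\<mu> \<in> TC V" "\<nu> \<in> TC V"
  shows "tc_norm d V (\<mu> + \<nu>) \<le> tc_norm d V \<mu> + tc_norm d V \<nu>"
proof -
  have le: "tc_norm d V (\<mu> + \<nu>) - cost rs \<le> cost qs"
    if "rs \<in> tc_reps V \<mu>" "qs \<in> tc_reps V \<nu>" for rs qs
  proof -
    have "rs @ qs \<in> tc_reps V (\<mu> + \<nu>)"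
      using that by (auto simp: tc_reps_def plus_fun_def)
    then show ?thesis
      using tc_norm_le by fastforce
  qed
  have "tc_norm d V (\<mu> + \<nu>) - cost rs \<le> tc_norm d V \<nu>" if "rs \<in> tc_reps V \<mu>" for rs
    using that assms by (intro tc_norm_greatest le)
  then have "tc_norm d V (\<mu> + \<nu>) - tc_norm d V \<nu> \<le> tc_norm d V \<mu>"
    using assms by (intro tc_norm_greatest) (auto simp: diff_le_eq add.commute)
  then show ?thesis
    by simp
qed

text \<open>A representation is scaled by \<open>\<bar>c\<bar>\<close>, with the endpoints of each
  term swapped when \<open>c < 0\<close>; symmetry of \<open>d\<close> preserves the cost.\<close>

lemma tc_norm_scale_le:
  assumes "\<mu> \<in> TC V"
  shows "tc_norm d V (c *\<^sub>R \<mu>) \<le> \<bar>c\<bar> * tc_norm d V \<mu>"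
proof (cases "c = 0")
  case True
  have "[] \<in> tc_reps V (0 *\<^sub>R \<mu>)"
    by (simp add: tc_reps_def zero_fun_def)
  then show ?thesis
    using tc_norm_le True by fastforce
next
  case False
  have "tc_norm d V (c *\<^sub>R \<mu>) / \<bar>c\<bar> \<le> cost rs" if rs: "rs \<in> tc_reps V \<mu>" for rs
  proof -
    let ?qs = "map (\<lambda>(a, x, y). if 0 \<le> c then (c * a, x, y) else (- c * a, y, x)) rs"
    have "(\<Sum>(a, x, y)\<leftarrow>?qs. a * ((if z = x then 1 else 0) - (if z = y then 1 else 0)))
        = (\<Sum>t\<leftarrow>rs. c * (case t of (a, x, y) \<Rightarrow> a * ((if z = x then 1 else 0) - (if z = y then 1 else 0))))" for z
      by (auto simp: o_def algebra_simps intro!: arg_cong[where f = sum_list])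
    moreover have "\<forall>(a, x, y)\<in>set ?qs. 0 \<le> a \<and> x \<in> V \<and> y \<in> V"
    proof
      fix q assume "q \<in> set ?qs"
      then obtain a x y where "(a, x, y) \<in> set rs"
        and q: "q = (if 0 \<le> c then (c * a, x, y) else (- c * a, y, x))"
        by auto
      then have "0 \<le> a" "x \<in> V" "y \<in> V"
        using rs by (auto simp: tc_reps_def)
      then show "case q of (a, x, y) \<Rightarrow> 0 \<le> a \<and> x \<in> V \<and> y \<in> V"
        by (auto simp: q mult_nonpos_nonneg)
    qed
    moreover have "\<mu> = (\<lambda>z. \<Sum>(a, x, y)\<leftarrow>rs. a * ((if z = x then 1 else 0) - (if z = y then 1 else 0)))"
      using rs by (simp add: tc_reps_def)
    ultimately have "?qs \<in> tc_reps V (c *\<^sub>R \<mu>)"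
      unfolding tc_reps_def mem_Collect_eq scaleR_fun_def real_scaleR_def
      by (simp only: sum_list_const_mult simp_thms)
    then have "tc_norm d V (c *\<^sub>R \<mu>) \<le> cost ?qs"
      by (rule tc_norm_le)
    also have "cost ?qs = (\<Sum>t\<leftarrow>rs. \<bar>c\<bar> * (case t of (a, x, y) \<Rightarrow> a * d x y))"
      unfolding map_map o_def
    proof (intro arg_cong[where f = sum_list] map_cong refl)
      fix t assume "t \<in> set rs"
      then obtain a x y where t: "t = (a, x, y)" "x \<in> V" "y \<in> V"
        using rs by (cases t) (auto simp: tc_reps_def)
      then show "(case (case t of (a, x, y) \<Rightarrow> if 0 \<le> c then (c * a, x, y) else (- c * a, y, x))
          of (a, x, y) \<Rightarrow> a * d x y) = \<bar>c\<bar> * (case t of (a, x, y) \<Rightarrow> a * d x y)"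
        using d_commute[of x y] by simp
    qed
    also have "\<dots> = \<bar>c\<bar> * cost rs"
      by (rule sum_list_const_mult)
    finally show ?thesis
      using False by (simp add: field_simps)
  qed
  then have "tc_norm d V (c *\<^sub>R \<mu>) / \<bar>c\<bar> \<le> tc_norm d V \<mu>"
    using assms by (intro tc_norm_greatest)
  then show ?thesis
    using False by (simp add: field_simps)
qed

definition dirac :: "'v \<Rightarrow> 'v \<Rightarrow> real" where
  "dirac x = (\<lambda>z. if z = x then 1 else 0)"

lemma tc_norm_dirac_diff:
  assumes "u \<in> V" "v \<in> V"
  shows "tc_norm d V (dirac u - dirac v) \<le> d u v"
  using tc_norm_le[of "[(1, u, v)]" "dirac u - dirac v"] assms
  by (simp add: tc_reps_def dirac_def fun_eq_iff)

text \<open>A linear projection onto \<open>TC V\<close> that discards values outside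
  \<open>V\<close> and removes the total mass at \<open>r\<close>. It extends the transportation
  norm to a seminorm on all functions.\<close>

definition proj :: "('v \<Rightarrow> real) \<Rightarrow> 'v \<Rightarrow> real" where
  "proj \<mu> = (\<lambda>x. if x \<in> V then \<mu> x - (if x = r then sum \<mu> V else 0) else 0)"

lemma proj_in_TC: "proj \<mu> \<in> TC V"
  using fin root by (simp add: TC_def proj_def sum_subtractf)

lemma proj_id: "\<mu> \<in> TC V \<Longrightarrow> proj \<mu> = \<mu>"
  by (auto simp: TC_def proj_def)

lemma proj_add: "proj (\<mu> + \<nu>) = proj \<mu> + proj \<nu>"
  by (auto simp: proj_def fun_eq_iff sum.distrib)

lemma proj_scale: "proj (c *\<^sub>R \<mu>) = c *\<^sub>R proj \<mu>"
  by (auto simp: proj_def fun_eq_iff sum_distrib_left algebra_simps)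

lemma proj_diff: "proj (\<mu> - \<nu>) = proj \<mu> - proj \<nu>"
  by (auto simp: proj_def fun_eq_iff sum_subtractf)

lemma seminorm_tc: "seminorm (\<lambda>\<mu>. tc_norm d V (proj \<mu>))"
  by (rule seminormI)
    (simp_all add: proj_add proj_scale tc_norm_triangle tc_norm_scale_le proj_in_TC)

lemma sum_dirac: "\<mu> \<in> TC V \<Longrightarrow> (\<Sum>x\<in>V. \<mu> x *\<^sub>R dirac x) = \<mu>"
  using fin by (auto simp: TC_def dirac_def fun_eq_iff if_distrib cong: if_cong)

lemma dirac_diff_in_TC: "u \<in> V \<Longrightarrow> v \<in> V \<Longrightarrow> dirac u - dirac v \<in> TC V"
  using fin by (auto simp: TC_def dirac_def sum_subtractf)

end

section \<open>The distortion bound\<close>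

text \<open>With signs \<open>\<sigma> i\<close>, the sum of absolute values is the inner product of
  \<open>a\<close> with \<open>g\<close>. By orthogonality the squared norm of \<open>g\<close> is a
  sum of \<open>card S\<close> terms, each at most \<open>card S\<close>; Cauchy-Schwarz
  concludes.\<close>

lemma orthogonal_average_le:
  fixes \<theta> :: "'t \<Rightarrow> 't \<Rightarrow> real"
  assumes "finite S"
    and orth: "\<And>i j. i \<in> S \<Longrightarrow> j \<in> S \<Longrightarrow> i \<noteq> j \<Longrightarrow> (\<Sum>t\<in>S. \<theta> i t * \<theta> j t) = 0"
    and bound: "\<And>i t. i \<in> S \<Longrightarrow> t \<in> S \<Longrightarrow> \<bar>\<theta> i t\<bar> \<le> 1"
  shows "(\<Sum>i\<in>S. 1 / card S * \<bar>\<Sum>t\<in>S. \<theta> i t * a t\<bar>) \<le> sqrt (\<Sum>t\<in>S. (a t)\<^sup>2)"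
proof -
  define \<sigma> where "\<sigma> i = sgn (\<Sum>t\<in>S. \<theta> i t * a t)" for i
  define g where "g t = (\<Sum>i\<in>S. \<sigma> i * \<theta> i t)" for t
  have "(\<Sum>i\<in>S. \<bar>\<Sum>t\<in>S. \<theta> i t * a t\<bar>) = (\<Sum>i\<in>S. \<Sum>t\<in>S. \<sigma> i * \<theta> i t * a t)"
    unfolding mult.assoc sum_distrib_left[symmetric] \<sigma>_def
    by (intro sum.cong refl) (metis abs_sgn mult.commute)
  also have "\<dots> = (\<Sum>t\<in>S. g t * a t)"
    unfolding g_def sum_distrib_right by (rule sum.swap)
  finally have eq: "(\<Sum>i\<in>S. \<bar>\<Sum>t\<in>S. \<theta> i t * a t\<bar>) = (\<Sum>t\<in>S. g t * a t)" .
  have "(\<Sum>t\<in>S. (g t)\<^sup>2) = (\<Sum>t\<in>S. \<Sum>i\<in>S. \<Sum>j\<in>S. \<sigma> i * \<sigma> j * (\<theta> i t * \<theta> j t))"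
    by (simp add: g_def power2_eq_square sum_product mult_ac)
  also have "\<dots> = (\<Sum>i\<in>S. \<Sum>t\<in>S. \<Sum>j\<in>S. \<sigma> i * \<sigma> j * (\<theta> i t * \<theta> j t))"
    by (rule sum.swap)
  also have "\<dots> = (\<Sum>i\<in>S. \<Sum>j\<in>S. \<sigma> i * \<sigma> j * (\<Sum>t\<in>S. \<theta> i t * \<theta> j t))"
    unfolding sum_distrib_left by (intro sum.cong refl sum.swap)
  also have "\<dots> = (\<Sum>i\<in>S. \<Sum>j\<in>S. if i = j then (\<sigma> i)\<^sup>2 * (\<Sum>t\<in>S. (\<theta> i t)\<^sup>2) else 0)"
    using orth by (intro sum.cong refl) (auto simp: power2_eq_square)
  also have "\<dots> = (\<Sum>i\<in>S. (\<sigma> i)\<^sup>2 * (\<Sum>t\<in>S. (\<theta> i t)\<^sup>2))"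
    using assms(1) by simp
  also have "\<dots> \<le> (\<Sum>i\<in>S. 1 * (\<Sum>t\<in>S. 1))"
    using bound by (intro sum_mono mult_mono)
      (auto simp: \<sigma>_def sgn_if abs_square_le_1 intro: sum_nonneg)
  finally have g: "(\<Sum>t\<in>S. (g t)\<^sup>2) \<le> (card S)\<^sup>2"
    by (simp add: power2_eq_square)
  have "(\<Sum>t\<in>S. g t * a t)\<^sup>2 \<le> (\<Sum>t\<in>S. (g t)\<^sup>2) * (\<Sum>t\<in>S. (a t)\<^sup>2)"
    by (rule Cauchy_Schwarz_ineq_sum)
  also have "\<dots> \<le> (card S)\<^sup>2 * (\<Sum>t\<in>S. (a t)\<^sup>2)"
    using g by (intro mult_right_mono sum_nonneg) auto
  finally have "(\<Sum>t\<in>S. g t * a t) \<le> card S * sqrt (\<Sum>t\<in>S. (a t)\<^sup>2)"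
    using real_le_rsqrt by (fastforce simp: real_sqrt_mult)
  then have "(\<Sum>i\<in>S. \<bar>\<Sum>t\<in>S. \<theta> i t * a t\<bar>) / card S \<le> sqrt (\<Sum>t\<in>S. (a t)\<^sup>2)"
    unfolding eq using assms(1)
    by (cases "S = {}") (auto simp: field_simps card_gt_0_iff)
  then show ?thesis
    by (simp add: sum_divide_distrib)
qed

theorem theorem2p1:
  fixes V :: "'v set" and E :: "('v \<times> 'v) set" and w :: "'v \<Rightarrow> 'v \<Rightarrow> real"
    and n' :: nat and Mk :: "nat \<Rightarrow> 't set" and \<mu> :: "'t \<Rightarrow> 'v \<Rightarrow> real"
    and C :: real and th :: "'v \<Rightarrow> 'v \<Rightarrow> real"
    and \<alpha> :: "nat \<Rightarrow> real" and \<theta> :: "nat \<Rightarrow> 't \<Rightarrow> 't \<Rightarrow> real"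
  assumes finV: "finite V"
    and E_sub: "E \<subseteq> V \<times> V"
    and E_noloop: "\<forall>u. (u, u) \<notin> E"
    and E_orient: "\<forall>u v. (u, v) \<in> E \<longrightarrow> (v, u) \<notin> E"
    and conn: "connected_graph V E"
    and w_pos: "\<forall>(u, v) \<in> E. 0 < w u v"
    and dG_edge: "\<forall>(u, v) \<in> E. dG E w u v = w u v"
    and Mk_fin: "\<forall>k \<le> n'. finite (Mk k)"
    and Mk_ne: "\<forall>k \<le> n'. Mk k \<noteq> {}"
    and Mk_disj: "\<forall>k \<le> n'. \<forall>l \<le> n'. k \<noteq> l \<longrightarrow> Mk k \<inter> Mk l = {}"
    and \<mu>_TC: "\<forall>k \<le> n'. \<forall>t \<in> Mk k. \<mu> t \<in> TC V"
    and C_pos: "0 < C"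
    and th_pos: "\<forall>(u, v) \<in> E. 0 < th u v"
    and th_norm: "(\<Sum>(u, v) \<in> E. th u v * dG E w u v) = 1"
    and C1: "\<forall>f :: 'v \<Rightarrow> real.
       (\<Sum>k = 0..n'. sqrt (\<Sum>t \<in> Mk k. (\<Sum>x \<in> V. f x * \<mu> t x)\<^sup>2))
         \<le> C * (\<Sum>(u, v) \<in> E. \<bar>f u - f v\<bar> * th u v)"
    and C2_alpha: "\<forall>k \<le> n'. 0 \<le> \<alpha> k"
    and C2_orth: "\<forall>k \<le> n'. \<forall>i \<in> Mk k. \<forall>j \<in> Mk k. i \<noteq> j \<longrightarrow>
                     (\<Sum>t \<in> Mk k. \<theta> k i t * \<theta> k j t) = 0"
    and C2_bound: "\<forall>k \<le> n'. \<forall>i \<in> Mk k. \<forall>t \<in> Mk k. \<bar>\<theta> k i t\<bar> \<le> 1"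
    and C2_min: "\<forall>k \<le> n'. \<forall>i \<in> Mk k.
        \<alpha> k \<le> tc_norm (dG E w) V (\<lambda>x. \<Sum>t \<in> Mk k. \<theta> k i t * \<mu> t x)"
  shows "ereal ((\<Sum>k = 0..n'. \<alpha> k) / C)
           \<le> c1 (TC V) (\<lambda>\<mu>1 \<mu>2. tc_norm (dG E w) V (\<lambda>x. \<mu>1 x - \<mu>2 x)) TYPE('b)"
proof -
  have "E \<noteq> {}"
    using th_norm by auto
  then obtain r where r: "r \<in> V"
    using E_sub by auto
  have edge: "u \<in> V" "v \<in> V" "0 < th u v" if "(u, v) \<in> E" for u v
    using that E_sub th_pos by auto
  interpret transport V "dG E w" r
    by unfold_locales (fact finV, fact r, rule dG_nonneg[OF w_pos conn], assumption, assumption, rule dG_commute[OF E_orient])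
  let ?d = "dG E w"
  let ?I = "SIGMA k:{0..n'}. Mk k"
  have "(\<Sum>k = 0..n'. \<alpha> k) / C \<le> D"
    if "1 \<le> D" and int: "\<forall>x\<in>TC V. integrable M (F x)"
      and lower: "\<And>x y. x \<in> TC V \<Longrightarrow> y \<in> TC V \<Longrightarrow>
        tc_norm ?d V (x - y) \<le> (\<integral>\<omega>. \<bar>F x \<omega> - F y \<omega>\<bar> \<partial>M)"
      and upper: "\<And>x y. x \<in> TC V \<Longrightarrow> y \<in> TC V \<Longrightarrow>
        (\<integral>\<omega>. \<bar>F x \<omega> - F y \<omega>\<bar> \<partial>M) \<le> D * tc_norm ?d V (x - y)"
    for D and M :: "'b measure" and F
  proof -
    \<comment> \<open>The embedding is controlled only on \<open>TC V\<close>, and its values are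
      integrable only there; \<open>proj\<close> and \<open>Q\<close> extend both sides to total
      seminorms with the same bounds.\<close>
    obtain Q :: "('b \<Rightarrow> real) \<Rightarrow> 'b \<Rightarrow> real" where Q: "linear Q" "\<And>f. integrable M (Q f)"
      "\<And>f. integrable M f \<Longrightarrow> Q f = f"
      using exists_integrable_projection by blast
    define p where "p f = (\<integral>\<omega>. \<bar>Q f \<omega>\<bar> \<partial>M)" for f
    define \<rho> where "\<rho> \<nu> = tc_norm ?d V (proj \<nu>)" for \<nu>
    interpret lipschitz_between \<rho> p D
    proof (rule lipschitz_between.intro)
      show "seminorm \<rho>" "seminorm p"
        using seminorm_tc seminorm_L1[OF Q(1,2)] unfolding \<rho>_def p_def by blast+
    qed (use \<open>1 \<le> D\<close> in unfold_locales, simp)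
    let ?F = "\<lambda>\<nu>. F (proj \<nu>)"
    have pF: "p (?F x - ?F y) = (\<integral>\<omega>. \<bar>F (proj x) \<omega> - F (proj y) \<omega>\<bar> \<partial>M)" for x y
      using int proj_in_TC by (simp add: p_def Q linear_diff[OF Q(1)])
    have lowerF: "\<rho> (x - y) \<le> p (?F x - ?F y)" for x y
      using lower proj_in_TC by (simp add: pF \<rho>_def proj_diff)
    have lipF: "lip ?F"
      using upper proj_in_TC by (simp add: lip_def pF \<rho>_def proj_diff)
    \<comment> \<open>The measures of (C2), read as coefficients over point masses; the weights
      \<open>lam\<close> will average over each \<open>Mk k\<close>.\<close>
    define c where "c = (\<lambda>(k, i) x. \<Sum>t\<in>Mk k. \<theta> k i t * \<mu> t x)"
    define lam :: "nat \<times> 't \<Rightarrow> real" where "lam = (\<lambda>(k, i). 1 / card (Mk k))"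
    have c_TC: "c i \<in> TC V" if mem: "i \<in> ?I" for i
    proof -
      obtain k j where i: "i = (k, j)" "k \<le> n'"
        using mem by auto
      have "(\<Sum>x\<in>V. c i x) = (\<Sum>t\<in>Mk k. \<Sum>x\<in>V. \<theta> k j t * \<mu> t x)"
        unfolding i(1) c_def prod.case by (rule sum.swap)
      also have "\<dots> = 0"
        using \<mu>_TC i(2) by (simp add: TC_def flip: sum_distrib_left)
      finally show ?thesis
        using \<mu>_TC i by (auto simp: TC_def c_def)
    qed
    \<comment> \<open>In each of the \<open>n' + 1\<close> layers the weights sum to one, so each
      layer loses exactly one \<open>\<epsilon>\<close>.\<close>
    have "(\<Sum>k = 0..n'. \<alpha> k) - real (Suc n') * \<epsilon> \<le> C * D" if pos: "0 < \<epsilon>" for \<epsilon>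
    proof -
      have finI: "finite ?I"
        using Mk_fin by auto
      have lam_nonneg: "0 \<le> lam i" for i
        by (simp add: lam_def split: prod.split)
      \<comment> \<open>The lattice directions are the point masses. For \<open>x\<close> in
        \<open>V\<close>, \<open>dirac x\<close> lies outside \<open>TC V\<close>, and
        \<open>\<rho>\<close> measures it as \<open>dirac x - dirac r\<close>.\<close>
      obtain A where A: "\<And>u v. p (A u - A v) \<le> D * \<rho> (dirac u - dirac v)"
        "(\<Sum>i\<in>?I. lam i * (\<rho> (\<Sum>x\<in>V. c i x *\<^sub>R dirac x) - \<epsilon>))
          \<le> (\<Sum>i\<in>?I. lam i * p (\<Sum>x\<in>V. c i x *\<^sub>R A x))"
        using linearization[where lam = lam and c = c and e = dirac, OF finV finI pos lam_nonneg lowerF lipF]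
        by blast
      define B where "B x = Q (A x)" for x
      have intB: "integrable M (B x)" for x
        by (simp add: B_def Q)
      have pc: "p (\<Sum>x\<in>V. c i x *\<^sub>R A x) = (\<integral>\<omega>. \<bar>\<Sum>x\<in>V. c i x * B x \<omega>\<bar> \<partial>M)" for i
        by (simp add: p_def B_def linear_sum[OF Q(1)] linear_scale[OF Q(1)])
      have "(\<Sum>k = 0..n'. \<alpha> k) - real (Suc n') * \<epsilon> = (\<Sum>k = 0..n'. \<Sum>i\<in>Mk k. 1 / card (Mk k) * (\<alpha> k - \<epsilon>))"
        using Mk_fin Mk_ne by (simp add: sum_subtractf)
      also have "\<dots> = (\<Sum>(k, i)\<in>?I. 1 / card (Mk k) * (\<alpha> k - \<epsilon>))"
        using Mk_fin by (intro sum.Sigma) auto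
      also have "\<dots> \<le> (\<Sum>i\<in>?I. lam i * (\<rho> (\<Sum>x\<in>V. c i x *\<^sub>R dirac x) - \<epsilon>))"
      proof (rule sum_mono)
        fix i assume i: "i \<in> ?I"
        then have "\<rho> (\<Sum>x\<in>V. c i x *\<^sub>R dirac x) = tc_norm ?d V (c i)"
          using c_TC by (simp add: \<rho>_def sum_dirac proj_id)
        then show "(case i of (k, i) \<Rightarrow> 1 / card (Mk k) * (\<alpha> k - \<epsilon>))
            \<le> lam i * (\<rho> (\<Sum>x\<in>V. c i x *\<^sub>R dirac x) - \<epsilon>)"
          using i C2_min by (auto simp: lam_def c_def divide_right_mono)
      qed
      also note A(2)
      also have "(\<Sum>i\<in>?I. lam i * p (\<Sum>x\<in>V. c i x *\<^sub>R A x))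
          = (\<integral>\<omega>. (\<Sum>i\<in>?I. lam i * \<bar>\<Sum>x\<in>V. c i x * B x \<omega>\<bar>) \<partial>M)"
        unfolding pc using intB by simp
      also have "\<dots> \<le> (\<integral>\<omega>. C * (\<Sum>(u, v)\<in>E. \<bar>B u \<omega> - B v \<omega>\<bar> * th u v) \<partial>M)"
      proof (rule integral_mono)
        fix \<omega>
        have "(\<Sum>i\<in>?I. lam i * \<bar>\<Sum>x\<in>V. c i x * B x \<omega>\<bar>)
            = (\<Sum>(k, i)\<in>?I. 1 / card (Mk k) * \<bar>\<Sum>t\<in>Mk k. \<theta> k i t * (\<Sum>x\<in>V. B x \<omega> * \<mu> t x)\<bar>)"
        proof (intro sum.cong refl, clarify)
          fix k i
          have "(\<Sum>x\<in>V. c (k, i) x * B x \<omega>) = (\<Sum>x\<in>V. \<Sum>t\<in>Mk k. \<theta> k i t * (B x \<omega> * \<mu> t x))"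
            by (simp add: c_def sum_distrib_left sum_distrib_right mult_ac)
          also have "\<dots> = (\<Sum>t\<in>Mk k. \<theta> k i t * (\<Sum>x\<in>V. B x \<omega> * \<mu> t x))"
            unfolding sum_distrib_left by (rule sum.swap)
          finally show "lam (k, i) * \<bar>\<Sum>x\<in>V. c (k, i) x * B x \<omega>\<bar>
              = 1 / card (Mk k) * \<bar>\<Sum>t\<in>Mk k. \<theta> k i t * (\<Sum>x\<in>V. B x \<omega> * \<mu> t x)\<bar>"
            by (simp add: lam_def)
        qed
        also have "\<dots> = (\<Sum>k = 0..n'. \<Sum>i\<in>Mk k. 1 / card (Mk k) *
            \<bar>\<Sum>t\<in>Mk k. \<theta> k i t * (\<Sum>x\<in>V. B x \<omega> * \<mu> t x)\<bar>)"
          using Mk_fin by (intro sum.Sigma[symmetric]) auto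
        also have "\<dots> \<le> (\<Sum>k = 0..n'. sqrt (\<Sum>t\<in>Mk k. (\<Sum>x\<in>V. B x \<omega> * \<mu> t x)\<^sup>2))"
          using Mk_fin C2_orth C2_bound by (intro sum_mono orthogonal_average_le) auto
        also have "\<dots> \<le> C * (\<Sum>(u, v)\<in>E. \<bar>B u \<omega> - B v \<omega>\<bar> * th u v)"
          using C1[rule_format, of "\<lambda>x. B x \<omega>"] .
        finally show "(\<Sum>i\<in>?I. lam i * \<bar>\<Sum>x\<in>V. c i x * B x \<omega>\<bar>)
            \<le> C * (\<Sum>(u, v)\<in>E. \<bar>B u \<omega> - B v \<omega>\<bar> * th u v)" .
      qed (use intB in \<open>simp_all add: case_prod_unfold\<close>)
      also have "\<dots> = C * (\<Sum>(u, v)\<in>E. p (A u - A v) * th u v)"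
        using intB by (simp add: case_prod_unfold p_def linear_diff[OF Q(1)] flip: B_def)
      \<comment> \<open>On an edge, \<open>dirac u - dirac v\<close> has transportation norm at most
        \<open>?d u v\<close>; the normalization of \<open>th\<close> then turns the sum into
        \<open>C * D\<close>.\<close>
      also have "\<dots> \<le> C * (\<Sum>(u, v)\<in>E. D * (th u v * ?d u v))"
      proof (intro mult_left_mono sum_mono, clarify)
        fix u v assume uv: "(u, v) \<in> E"
        have "\<rho> (dirac u - dirac v) \<le> ?d u v"
          using edge(1,2)[OF uv] by (simp add: \<rho>_def proj_id dirac_diff_in_TC tc_norm_dirac_diff)
        then have "p (A u - A v) \<le> D * ?d u v"
          using A(1)[of u v] D_nonneg by (meson mult_left_mono order_trans)
        then show "p (A u - A v) * th u v \<le> D * (th u v * ?d u v)"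
          using mult_right_mono[of _ _ "th u v"] edge(3)[OF uv] by (fastforce simp: mult_ac)
      qed (use C_pos in simp)
      also have "\<dots> = C * (D * (\<Sum>(u, v)\<in>E. th u v * ?d u v))"
        by (simp add: sum_distrib_left case_prod_unfold)
      finally show ?thesis
        using th_norm by simp
    qed
    then have "(\<Sum>k = 0..n'. \<alpha> k) \<le> C * D + \<delta>" if "0 < \<delta>" for \<delta>
      using that by (fastforce dest: spec[of _ "\<delta> / real (Suc n')"])
    then have "(\<Sum>k = 0..n'. \<alpha> k) \<le> C * D"
      by (rule field_le_epsilon)
    then show ?thesis
      using C_pos by (simp add: field_simps)
  qed
  then show ?thesis
    unfolding c1_def by (intro Inf_greatest) (auto simp: fun_diff_def)
qed

end
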